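(* Let $\xi>-1$ be real and let $c\in\mathbb{R}$ be neither $0$ nor a negative integer. Then the operator $\widetilde{L}=z\frac{d}{dz}+c$, $\widetilde{L}f(z)=zf'(z)+cf(z)$, extends to an isomorphism between $\mathcal{A}_\xi^2$ and $\mathcal{A}_{\xi+2}^2$, i.e. a bounded linear bijection $\mathcal{A}_\xi^2\to\mathcal{A}_{\xi+2}^2$ with bounded inverse.
   Context: $\mathbb{D}=\{z\in\mathbb{C}:|z|<1\}$, $H(\mathbb{D})$ is the space of holomorphic functions on $\mathbb{D}$, and $dz$ denotes the Euclidean (area) measure on $\mathbb{C}$. For real $\xi>-1$ let $d\nu_\xi(z)=\frac{\xi+1}{\pi}(1-|z|^2)^\xi\,dz$, a probability measure on $\mathbb{D}$. The weighted Bergman space $\mathcal{A}_\xi^2$ is the Hilbert space of $f\in H(\mathbb{D})$ with $\|f\|_\xi^2=\int_{\mathbb{D}}|f|^2\,d\nu_\xi<\infty$, with inner product $\langle f,g\rangle_\xi=\int_{\mathbb{D}}f\overline{g}\,d\nu_\xi$. On power series, $\widetilde{L}$ acts by $\sum_k a_kz^k\mapsto\sum_k(k+c)a_kz^k$. Isomorphism is meant in the sense of topological vector spaces (not necessarily isometric). *)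

theory Defs
  imports "HOL-Complex_Analysis.Complex_Analysis"
begin

definition bergman_measure :: "real \<Rightarrow> complex measure" where
  "bergman_measure \<xi> = density (restrict_space lborel (ball 0 1))
     (\<lambda>z. ennreal ((\<xi> + 1) / pi * (1 - (cmod z)\<^sup>2) powr \<xi>))"

text \<open>
  HOL functions are total, so a function on the disc is represented by its extension by zero
  to the plane. Equality in this set is then equality on the disc.
\<close>

definition bergman_space :: "real \<Rightarrow> (complex \<Rightarrow> complex) set" where
  "bergman_space \<xi> = {f. f holomorphic_on ball 0 1 \<and> (\<forall>z. z \<notin> ball 0 1 \<longrightarrow> f z = 0) \<and>
     integrable (bergman_measure \<xi>) (\<lambda>z. (cmod (f z))\<^sup>2)}"

definition bergman_norm :: "real \<Rightarrow> (complex \<Rightarrow> complex) \<Rightarrow> real" where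
  "bergman_norm \<xi> f = sqrt (\<integral>z. (cmod (f z))\<^sup>2 \<partial>bergman_measure \<xi>)"

definition L_op :: "real \<Rightarrow> (complex \<Rightarrow> complex) \<Rightarrow> complex \<Rightarrow> complex" where
  "L_op c f = (\<lambda>z. if z \<in> ball 0 1 then z * deriv f z + of_real c * f z else 0)"

definition linear_between ::
  "('a \<Rightarrow> complex) set \<Rightarrow> (('a \<Rightarrow> complex) \<Rightarrow> 'b \<Rightarrow> complex) \<Rightarrow> bool" where
  "linear_between X T \<longleftrightarrow>
     (\<forall>f\<in>X. \<forall>g\<in>X. T (\<lambda>z. f z + g z) = (\<lambda>z. T f z + T g z)) \<and>
     (\<forall>a. \<forall>f\<in>X. T (\<lambda>z. a * f z) = (\<lambda>z. a * T f z))"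

text \<open>
  An isomorphism of topological vector spaces between the function spaces \<open>X\<close> and \<open>Y\<close>,
  normed by \<open>nX\<close> and \<open>nY\<close>; it need not be isometric.
\<close>

definition normed_space_iso ::
  "('a \<Rightarrow> complex) set \<Rightarrow> (('a \<Rightarrow> complex) \<Rightarrow> real) \<Rightarrow>
   ('b \<Rightarrow> complex) set \<Rightarrow> (('b \<Rightarrow> complex) \<Rightarrow> real) \<Rightarrow>
   (('a \<Rightarrow> complex) \<Rightarrow> 'b \<Rightarrow> complex) \<Rightarrow> bool" where
  "normed_space_iso X nX Y nY T \<longleftrightarrow>
     linear_between X T \<and> bij_betw T X Y \<and>
     (\<exists>C. \<forall>f\<in>X. nY (T f) \<le> C * nX f) \<and>
     (\<exists>C. \<forall>g\<in>Y. nX (inv_into X T g) \<le> C * nY g)"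

lemma bergman_space_add:
  assumes "f \<in> bergman_space \<xi>" "g \<in> bergman_space \<xi>"
  shows "(\<lambda>z. f z + g z) \<in> bergman_space \<xi>"
proof -
  have hol: "(\<lambda>z. f z + g z) holomorphic_on ball 0 1"
    using assms by (auto simp: bergman_space_def intro: holomorphic_intros)
  have "(\<lambda>z. f z + g z) \<in> borel_measurable (restrict_space lborel (ball 0 1))"
    using borel_measurable_continuous_on_restrict[OF holomorphic_on_imp_continuous_on[OF hol]]
    by (simp add: measurable_def sets_restrict_space space_restrict_space)
  hence meas: "(\<lambda>z. f z + g z) \<in> borel_measurable (bergman_measure \<xi>)"
    by (simp add: bergman_measure_def)
  have int: "integrable (bergman_measure \<xi>) (\<lambda>z. 2 * (cmod (f z))\<^sup>2 + 2 * (cmod (g z))\<^sup>2)"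
    using assms by (auto simp: bergman_space_def)
  have le: "(cmod (f z + g z))\<^sup>2 \<le> 2 * (cmod (f z))\<^sup>2 + 2 * (cmod (g z))\<^sup>2" for z
  proof -
    have "(cmod (f z + g z))\<^sup>2 \<le> (cmod (f z) + cmod (g z))\<^sup>2"
      by (intro power_mono norm_triangle_ineq) simp
    also have "\<dots> \<le> 2 * (cmod (f z))\<^sup>2 + 2 * (cmod (g z))\<^sup>2"
      using sum_squares_bound[of "cmod (f z)" "cmod (g z)"] by (simp add: power2_sum)
    finally show ?thesis .
  qed
  have "integrable (bergman_measure \<xi>) (\<lambda>z. (cmod (f z + g z))\<^sup>2)"
    by (rule Bochner_Integration.integrable_bound[OF int]) (use meas le in auto)
  thus ?thesis using hol assms by (auto simp: bergman_space_def)
qed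

lemma bergman_space_scale:
  assumes "f \<in> bergman_space \<xi>"
  shows "(\<lambda>z. a * f z) \<in> bergman_space \<xi>"
  using assms
  by (auto simp: bergman_space_def norm_mult power_mult_distrib intro: holomorphic_intros)

end

theory Submission
  imports Defs "HOL-Real_Asymp.Real_Asymp"
begin

text \<open>
  On power series \<open>\<Sum>a k z\<^sup>k\<close> the operator multiplies the coefficient \<open>a k\<close> by \<open>k + c\<close>, and the
  Bergman norms are weighted \<open>l\<^sup>2\<close> norms of the coefficients:
  \[ \|f\|_\xi^2 = \sum_k |a_k|^2 w_\xi(k), \qquad w_\xi(k) = (\xi+1) B(k+1, \xi+1). \]
  The recurrence of the Beta function shows that \<open>(k + c)\<^sup>2 w\<close>, taken with the weight \<open>w\<close> for
  \<open>\<xi> + 2\<close>, differs from the weight for \<open>\<xi>\<close> by a factor that is a rational function of \<open>k\<close>,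
  positive for all \<open>k\<close> and convergent to a positive limit
  (lemma \<open>bergman_weight_comparable\<close>). So the square integrals of \<open>f\<close> and of its image are
  comparable for every holomorphic \<open>f\<close>, finite or not (lemma \<open>L_op_norm_equivalence\<close>). This
  gives boundedness, injectivity and boundedness of the inverse; a preimage of \<open>g\<close> is found by
  dividing its coefficients by \<open>k + c\<close>, and the same comparison puts it into the right space.

  The formula for the norm (lemma \<open>nn_integral_bergman_power_series\<close>) rests on two facts about
  the area measure. Rotations preserve it, which makes distinct monomials orthogonal on every
  disc around 0; and \<open>|z|\<^sup>2\<close> is uniformly distributed on the unit disc, which turns the norms
  of monomials into Beta integrals. Convergence is handled by dominated convergence on smaller
  discs and then by monotone convergence as the radius tends to 1.
\<close>

section \<open>Rotation invariance of the Lebesgue measure on the plane\<close>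

lemma lborel_complex_distr_pair:
  "distr lborel borel (\<lambda>(x, y). Complex x y) = lborel"
proof (rule lborel_eqI[symmetric])
  fix l u :: complex
  assume le: "\<And>b. b \<in> Basis \<Longrightarrow> l \<bullet> b \<le> u \<bullet> b"
  have le': "Re l \<le> Re u" "Im l \<le> Im u"
    using le[of 1] le[of \<i>] by (auto simp: Basis_complex_def)
  have meas: "(\<lambda>(x, y). Complex x y) \<in> borel_measurable (lborel :: (real \<times> real) measure)"
    by (auto simp: case_prod_beta Complex_eq intro!: borel_measurable_continuous_onI continuous_intros)
  have "(\<lambda>(x, y). Complex x y) -` box l u = box (Re l, Im l) (Re u, Im u)"
    by (auto simp: box_def Basis_complex_def Basis_prod_def)
  hence "emeasure (distr lborel borel (\<lambda>(x, y). Complex x y)) (box l u) =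
        emeasure lborel (box (Re l, Im l) (Re u, Im u))"
    by (subst emeasure_distr[OF meas]) auto
  also have "\<dots> = ennreal (\<Prod>b\<in>Basis. (u - l) \<bullet> b)"
  proof -
    have "(1,0) \<noteq> (0::real,1::real)" by simp
    thus ?thesis
      using le' by (subst emeasure_lborel_box)
         (auto simp: Basis_complex_def Basis_prod_def)
  qed
  finally show "emeasure (distr lborel borel (\<lambda>(x, y). Complex x y)) (box l u) =
      ennreal (\<Prod>b\<in>Basis. (u - l) \<bullet> b)" .
qed simp

text \<open>
  Tonelli's theorem reduces this to translation invariance of Lebesgue measure on each
  horizontal line.
\<close>

lemma lborel_shear_fst:
  fixes a :: real
  shows "distr lborel borel (\<lambda>(x, y). (x + a * y, y)) = (lborel :: (real \<times> real) measure)"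
proof (rule measure_eqI)
  fix A :: "(real \<times> real) set"
  assume "A \<in> sets (distr lborel borel (\<lambda>(x, y). (x + a * y, y)))"
  hence A [measurable]: "A \<in> sets borel" by simp
  have A': "A \<in> sets (borel \<Otimes>\<^sub>M borel)" using A by (simp only: borel_prod)
  have meas: "(\<lambda>(x, y). (x + a * y, y)) \<in> borel_measurable (lborel :: (real \<times> real) measure)"
    by (auto simp: case_prod_beta intro!: borel_measurable_continuous_onI continuous_intros)
  have ind: "(\<lambda>p. indicator A p :: ennreal) \<in> borel_measurable (lborel \<Otimes>\<^sub>M lborel)"
    unfolding lborel_prod by measurable
  have ind': "(\<lambda>p. indicator A (fst p + a * snd p, snd p) :: ennreal) \<in> borel_measurable (lborel \<Otimes>\<^sub>M lborel)"
    using A' by measurable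
  have "emeasure (distr lborel borel (\<lambda>(x, y). (x + a * y, y))) A =
      (\<integral>\<^sup>+p. indicator A p \<partial>distr lborel borel (\<lambda>(x, y). (x + a * y, y)))"
    by simp
  also have "\<dots> = (\<integral>\<^sup>+p. indicator A (fst p + a * snd p, snd p) \<partial>(lborel \<Otimes>\<^sub>M lborel))"
    using meas by (subst nn_integral_distr) (auto simp: case_prod_beta lborel_prod)
  also have "\<dots> = (\<integral>\<^sup>+y. \<integral>\<^sup>+x. indicator A (x + a * y, y) \<partial>lborel \<partial>lborel)"
    by (subst lborel_pair.nn_integral_snd[OF ind', symmetric]) simp
  also have "\<dots> = (\<integral>\<^sup>+y. \<integral>\<^sup>+x. indicator A (x, y) \<partial>lborel \<partial>lborel)"
  proof (rule nn_integral_cong)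
    fix y :: real
    have m: "(\<lambda>x. indicator A (x, y) :: ennreal) \<in> borel_measurable borel"
      using A' by measurable
    show "(\<integral>\<^sup>+x. indicator A (x + a * y, y) \<partial>lborel) = (\<integral>\<^sup>+x. indicator A (x, y) \<partial>lborel)"
      using nn_integral_real_affine[OF m, of 1 "a * y"] by (simp add: add.commute)
  qed
  also have "\<dots> = (\<integral>\<^sup>+p. indicator A p \<partial>(lborel \<Otimes>\<^sub>M lborel))"
    by (rule lborel_pair.nn_integral_snd[OF ind])
  also have "\<dots> = emeasure lborel A"
    by (simp add: lborel_prod)
  finally show "emeasure (distr lborel borel (\<lambda>(x, y). (x + a * y, y))) A = emeasure lborel A" .
qed simp

lemma lborel_distr_swap:
  "distr lborel borel (\<lambda>(x, y). (y, x)) = (lborel :: (real \<times> real) measure)"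
proof -
  have "(lborel :: (real \<times> real) measure) = distr lborel lborel (\<lambda>(x, y). (y, x))"
    using lborel_pair.distr_pair_swap[where 'a=real and 'b=real] by (simp only: lborel_prod)
  also have "\<dots> = distr lborel borel (\<lambda>(x, y). (y, x))"
    by (rule distr_cong) auto
  finally show ?thesis by simp
qed

lemma lborel_distr_comp:
  assumes "distr lborel borel f = lborel" "distr lborel borel g = lborel"
    and "f \<in> borel_measurable borel" "g \<in> borel_measurable borel"
  shows "distr lborel borel (\<lambda>x. f (g x)) = lborel"
proof -
  have "distr lborel borel (\<lambda>x. f (g x)) = distr (distr lborel borel g) borel f"
    using assms(3,4) by (subst distr_distr) (simp_all add: o_def)
  with assms show ?thesis by simp
qed

text \<open>
  A rotation by the angle \<open>\<theta>\<close> is a product of three shears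
  \[ (x, y) \mapsto (x - ty, y), \quad (x, y) \mapsto (x, y + sx), \quad (x, y) \mapsto (x - ty, y) \]
  with \<open>s = sin \<theta>\<close> and \<open>t = tan (\<theta>/2)\<close>, so its invariance follows from that of shears. This
  decomposition breaks down exactly at the half turn, where \<open>t\<close> is infinite.
\<close>

lemma lborel_rotation_ne_minus_1:
  assumes z: "cmod \<zeta> = 1" and ne: "\<zeta> \<noteq> -1"
  shows "distr lborel borel ((*) \<zeta>) = lborel"
proof -
  define s where "s = Im \<zeta>"
  define t where "t = s / (1 + Re \<zeta>)"
  define S where "S = (\<lambda>a::real. \<lambda>(x::real, y::real). (x + a * y, y))"
  define W where "W = (\<lambda>(x::real, y::real). (y, x))"
  define \<phi> where "\<phi> = (\<lambda>(x, y). Complex x y)"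
  have norm: "(Re \<zeta>)\<^sup>2 + s\<^sup>2 = 1" 
    using z by (simp add: cmod_def s_def)
  have nz: "1 + Re \<zeta> \<noteq> 0"
  proof
    assume "1 + Re \<zeta> = 0"
    hence "Re \<zeta> = -1" by simp
    moreover from this norm have "Im \<zeta> = 0" by (simp add: s_def)
    ultimately show False using ne by (simp add: complex_eq_iff)
  qed
  have ts: "t * s = 1 - Re \<zeta>"
    using norm nz by (simp add: t_def field_simps power2_eq_square)
  have tc: "t + t * Re \<zeta> = s"
  proof -
    have "t + t * Re \<zeta> = t * (1 + Re \<zeta>)" by (simp add: distrib_left)
    thus ?thesis using nz by (simp add: t_def)
  qed
  have [measurable]: "S a \<in> borel_measurable borel" for a
    unfolding S_def case_prod_beta by (intro borel_measurable_continuous_onI continuous_intros)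
  have [measurable]: "W \<in> borel_measurable borel"
    unfolding W_def case_prod_beta by (intro borel_measurable_continuous_onI continuous_intros)
  have [measurable]: "\<phi> \<in> borel_measurable borel"
    unfolding \<phi>_def case_prod_beta Complex_eq by (intro borel_measurable_continuous_onI continuous_intros)
  have S: "distr lborel borel (S a) = lborel" for a
    unfolding S_def by (rule lborel_shear_fst)
  have W: "distr lborel borel W = lborel"
    unfolding W_def by (rule lborel_distr_swap)
  (* The middle shear acts on the second coordinate; W swaps the coordinates for it. *)
  have eq: "\<zeta> * \<phi> p = \<phi> (S (-t) (W (S s (W (S (-t) p)))))" for p
  proof -
    obtain x y where p: "p = (x, y)" by (cases p)
    have "(x - t * y) - t * (y + s * (x - t * y)) = (1 - t * s) * x - (t + t * (1 - t * s)) * y"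
      by (simp add: algebra_simps)
    also have "\<dots> = Re \<zeta> * x - s * y" using tc by (simp add: ts)
    finally have 1: "(x - t * y) - t * (y + s * (x - t * y)) = Re \<zeta> * x - s * y" .
    have "y + s * (x - t * y) = s * x + (1 - t * s) * y" by (simp add: algebra_simps)
    also have "\<dots> = s * x + Re \<zeta> * y" by (simp add: ts)
    finally have 2: "y + s * (x - t * y) = s * x + Re \<zeta> * y" .
    show ?thesis using 1 2
      by (simp add: complex_eq_iff p S_def W_def \<phi>_def s_def)
  qed
  have D: "distr lborel borel (\<lambda>p. S (-t) (W (S s (W (S (-t) p))))) = lborel"
    by (rule lborel_distr_comp[OF S lborel_distr_comp[OF W lborel_distr_comp[OF S
          lborel_distr_comp[OF W S]]]]) measurable
  have \<phi>: "distr lborel borel \<phi> = lborel"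
    unfolding \<phi>_def by (rule lborel_complex_distr_pair)
  have "distr lborel borel ((*) \<zeta>) = distr (distr lborel borel \<phi>) borel ((*) \<zeta>)"
    by (simp add: \<phi>)
  also have "\<dots> = distr lborel borel (\<lambda>p. \<phi> (S (-t) (W (S s (W (S (-t) p))))))"
    by (subst distr_distr) (auto simp: o_def eq)
  also have "\<dots> = distr (distr lborel borel (\<lambda>p. S (-t) (W (S s (W (S (-t) p)))))) borel \<phi>"
    by (subst distr_distr) (auto simp: o_def)
  also have "\<dots> = lborel"
    by (simp add: D \<phi>)
  finally show ?thesis .
qed

lemma lborel_rotation:
  assumes "cmod \<zeta> = 1"
  shows "distr lborel borel ((*) \<zeta>) = lborel"
proof (cases "\<zeta> = -1")
  case True
  (* A half turn is two quarter turns. *)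
  have "distr lborel borel (\<lambda>z. \<i> * (\<i> * z)) = lborel"
    by (rule lborel_distr_comp) (auto intro!: lborel_rotation_ne_minus_1 simp: complex_eq_iff)
  with True show ?thesis by (simp add: mult.assoc[symmetric] cong: distr_cong)
qed (use assms lborel_rotation_ne_minus_1 in auto)

section \<open>Radial integrals over the disc\<close>

text \<open>
  The disc of radius \<open>\<surd>s\<close> has area \<open>\<pi> s\<close>, which is linear in \<open>s\<close>. Hence \<open>|z|\<^sup>2\<close> is
  uniformly distributed, and radial integrals over the disc become integrals over \<open>(0, 1)\<close>.
\<close>

lemma distr_cmod_square_disc:
  "distr (restrict_space lborel (ball (0::complex) 1)) borel (\<lambda>z. (cmod z)\<^sup>2) =
     density lborel (\<lambda>s. ennreal pi * indicator {0<..<1} s)"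
  (is "?M = ?N")
proof (rule measure_eqI_lessThan)
  have area: "emeasure lborel (ball (0::complex) 1) = ennreal pi"
    by (simp add: emeasure_ball unit_ball_vol_2)
  have M: "emeasure ?M {x<..} = ennreal (pi * max 0 (1 - max 0 x))" for x
  proof -
    have m: "(\<lambda>z. (cmod z)\<^sup>2) \<in> borel_measurable (restrict_space lborel (ball (0::complex) 1))"
      by (intro measurable_restrict_space1) measurable
    have "emeasure ?M {x<..} = emeasure lborel ((\<lambda>z. (cmod z)\<^sup>2) -` {x<..} \<inter> ball 0 1)"
      using m by (subst emeasure_distr) (auto simp: emeasure_restrict_space space_restrict_space)
    also have "\<dots> = ennreal (pi * max 0 (1 - max 0 x))"
    proof (cases "0 \<le> x")
      case False
      hence "(\<lambda>z. (cmod z)\<^sup>2) -` {x<..} \<inter> ball 0 1 = ball 0 1"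
        by (auto simp: not_le intro: less_le_trans[OF _ zero_le_power2])
      with False area show ?thesis by simp
    next
      case True
      have sq: "x < (cmod z)\<^sup>2 \<longleftrightarrow> sqrt x < cmod z" for z
        using real_sqrt_less_iff[of x "(cmod z)\<^sup>2"] by simp
      have sub: "(\<lambda>z. (cmod z)\<^sup>2) -` {x<..} \<inter> ball 0 1 = ball 0 1 - cball 0 (sqrt x)"
        using sq by auto
      show ?thesis
      proof (cases "x < 1")
        case False
        hence "ball 0 1 - cball (0::complex) (sqrt x) = {}" using True
          by auto (smt (verit) real_sqrt_ge_1_iff)
        with sub False show ?thesis by simp
      next
        case x1: True
        have "emeasure lborel (ball 0 1 - cball (0::complex) (sqrt x)) =
            emeasure lborel (ball (0::complex) 1) - emeasure lborel (cball (0::complex) (sqrt x))"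
        proof (rule emeasure_Diff)
          have "sqrt x < 1" using True x1 by (simp add: real_sqrt_lt_1_iff)
          thus "cball (0::complex) (sqrt x) \<subseteq> ball 0 1"
            by (auto simp del: real_sqrt_lt_1_iff)
        qed (use emeasure_bounded_finite[of "cball (0::complex) (sqrt x)"] in auto)
        also have "\<dots> = ennreal pi - ennreal (pi * x)"
          using True by (simp add: area emeasure_cball unit_ball_vol_2)
        also have "\<dots> = ennreal (pi * (1 - x))"
          using True by (simp add: ennreal_minus[symmetric] algebra_simps)
        finally show ?thesis using sub x1 True by simp
      qed
    qed
    finally show ?thesis .
  qed
  show "emeasure ?M {x<..} < \<infinity>" for x
    by (simp add: M)
  show "emeasure ?M {x<..} = emeasure ?N {x<..}" for x
  proof -
    have "emeasure ?N {x<..} = ennreal pi * emeasure lborel ({0<..<1} \<inter> {x<..})"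
      by (subst emeasure_density)
         (auto simp: nn_integral_cmult mult.assoc indicator_inter_arith[symmetric])
    also have "{0<..<1} \<inter> {x<..} = {max 0 x<..<1}"
      by auto
    also have "emeasure lborel \<dots> = ennreal (max 0 (1 - max 0 x))"
      by (cases "x < 1") (simp_all add: max_def)
    finally show ?thesis unfolding M by (simp add: ennreal_mult')
  qed
qed simp_all

section \<open>The measure of the Bergman space\<close>

lemma nn_integral_bergman_measure:
  assumes [measurable]: "f \<in> borel_measurable borel"
  shows "(\<integral>\<^sup>+z. f z \<partial>bergman_measure \<xi>) =
    (\<integral>\<^sup>+z. ennreal ((\<xi> + 1) / pi * (1 - (cmod z)\<^sup>2) powr \<xi>) * f z * indicator (ball 0 1) z \<partial>lborel)"
proof -
  have "f \<in> borel_measurable (restrict_space lborel (ball 0 1))"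
    by (intro measurable_restrict_space1) simp
  moreover have "(\<lambda>z. ennreal ((\<xi> + 1) / pi * (1 - (cmod z)\<^sup>2) powr \<xi>))
      \<in> borel_measurable (restrict_space lborel (ball 0 1))"
    by (intro measurable_restrict_space1) measurable
  ultimately show ?thesis
    unfolding bergman_measure_def
    by (subst nn_integral_density) (auto simp: nn_integral_restrict_space)
qed

lemma space_bergman_measure [simp]: "space (bergman_measure \<xi>) = ball 0 1"
  by (simp add: bergman_measure_def space_restrict_space)

lemma sets_bergman_measure [measurable_cong]:
  "sets (bergman_measure \<xi>) = sets (restrict_space borel (ball 0 1))"
  by (simp add: bergman_measure_def sets_restrict_space)

lemma borel_measurable_bergman_measure:
  "f \<in> borel_measurable borel \<Longrightarrow> f \<in> borel_measurable (bergman_measure \<xi>)"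
  by (simp add: measurable_restrict_space1 measurable_cong_sets[OF sets_bergman_measure refl])

lemma borel_measurable_bergman_measure_holomorphic:
  assumes "f holomorphic_on ball 0 1"
  shows "f \<in> borel_measurable (bergman_measure \<xi>)"
  using borel_measurable_continuous_on_restrict[OF holomorphic_on_imp_continuous_on[OF assms]]
  by (simp add: measurable_cong_sets[OF sets_bergman_measure refl])

lemma measurable_rotation_bergman_measure:
  assumes "cmod \<zeta> = 1"
  shows "(*) \<zeta> \<in> measurable (bergman_measure \<xi>) (bergman_measure \<xi>)"
  by (simp add: measurable_cong_sets[OF sets_bergman_measure sets_bergman_measure])
     (rule measurable_restrict_space3, auto simp: norm_mult assms)

lemma bergman_measure_rotation:
  assumes \<zeta>: "cmod \<zeta> = 1"
  shows "distr (bergman_measure \<xi>) (bergman_measure \<xi>) ((*) \<zeta>) = bergman_measure \<xi>"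
proof (rule measure_eqI)
  fix A assume "A \<in> sets (distr (bergman_measure \<xi>) (bergman_measure \<xi>) ((*) \<zeta>))"
  hence A: "A \<in> sets (bergman_measure \<xi>)" by simp
  have A_borel: "A \<in> sets borel"
    using A by (auto simp: sets_bergman_measure sets_restrict_space)
  note rot = measurable_rotation_bergman_measure[OF \<zeta>, of \<xi>]
  define g where "g = (\<lambda>z. ennreal ((\<xi> + 1) / pi * (1 - (cmod z)\<^sup>2) powr \<xi>) *
    indicator A z * indicator (ball 0 1) z)"
  have [measurable]: "A \<in> sets borel" "ball (0::complex) 1 \<in> sets borel"
    using A_borel by simp_all
  have [measurable]: "g \<in> borel_measurable borel"
    unfolding g_def by measurable
  have "emeasure (distr (bergman_measure \<xi>) (bergman_measure \<xi>) ((*) \<zeta>)) A =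
      (\<integral>\<^sup>+z. indicator A z \<partial>distr (bergman_measure \<xi>) (bergman_measure \<xi>) ((*) \<zeta>))"
    using A by simp
  also have "\<dots> = (\<integral>\<^sup>+z. indicator A (\<zeta> * z) \<partial>bergman_measure \<xi>)"
    using A rot by (subst nn_integral_distr) auto
  also have "\<dots> = (\<integral>\<^sup>+z. g (\<zeta> * z) \<partial>lborel)"
    using A_borel by (subst nn_integral_bergman_measure)
      (auto simp: g_def norm_mult \<zeta> indicator_def intro!: nn_integral_cong)
  also have "\<dots> = (\<integral>\<^sup>+z. g z \<partial>distr lborel borel ((*) \<zeta>))"
    by (subst nn_integral_distr) auto
  also have "\<dots> = (\<integral>\<^sup>+z. g z \<partial>lborel)"
    by (simp add: lborel_rotation[OF \<zeta>])
  also have "\<dots> = (\<integral>\<^sup>+z. indicator A z \<partial>bergman_measure \<xi>)"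
    using A_borel by (subst nn_integral_bergman_measure) (auto simp: g_def)
  also have "\<dots> = emeasure (bergman_measure \<xi>) A"
    using A by simp
  finally show "emeasure (distr (bergman_measure \<xi>) (bergman_measure \<xi>) ((*) \<zeta>)) A =
    emeasure (bergman_measure \<xi>) A" .
qed simp

text \<open>
  The square of the norm of \<open>z\<^sup>k\<close> in the Bergman space with parameter \<open>\<xi>\<close>.
\<close>

definition bergman_weight :: "real \<Rightarrow> nat \<Rightarrow> real" where
  "bergman_weight \<xi> k = (\<xi> + 1) * Beta (real k + 1) (\<xi> + 1)"

lemma nn_integral_bergman_power:
  assumes "\<xi> > -1"
  shows "(\<integral>\<^sup>+z. ennreal (cmod z ^ (2 * k)) \<partial>bergman_measure \<xi>) = ennreal (bergman_weight \<xi> k)"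
proof -
  define h where "h = (\<lambda>s::real. ennreal ((\<xi> + 1) / pi * (1 - s) powr \<xi>) * ennreal (s ^ k))"
  have [measurable]: "h \<in> borel_measurable borel"
    unfolding h_def by measurable
  have m: "(\<lambda>z. (cmod z)\<^sup>2) \<in> borel_measurable (restrict_space lborel (ball (0::complex) 1))"
    by (intro measurable_restrict_space1) measurable
  have "(\<integral>\<^sup>+z. ennreal (cmod z ^ (2 * k)) \<partial>bergman_measure \<xi>) =
      (\<integral>\<^sup>+z. h ((cmod z)\<^sup>2) \<partial>restrict_space lborel (ball (0::complex) 1))"
    by (subst nn_integral_bergman_measure)
       (auto simp: nn_integral_restrict_space h_def mult_ac simp flip: power_mult intro!: nn_integral_cong)
  also have "\<dots> = (\<integral>\<^sup>+s. h s \<partial>distr (restrict_space lborel (ball (0::complex) 1)) borel (\<lambda>z. (cmod z)\<^sup>2))"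
    using m by (subst nn_integral_distr) auto
  also have "\<dots> = (\<integral>\<^sup>+s. ennreal pi * indicator {0<..<1} s * h s \<partial>lborel)"
    unfolding distr_cmod_square_disc by (subst nn_integral_density) auto
  also have "\<dots> = (\<integral>\<^sup>+s. ennreal ((\<xi> + 1) * (s powr (real k + 1 - 1) * (1 - s) powr (\<xi> + 1 - 1))) *
      indicator {0<..<1} s \<partial>lborel)"
    using assms by (intro nn_integral_cong)
      (auto simp: h_def indicator_def powr_realpow mult_ac simp flip: ennreal_mult' ennreal_mult)
  also have "\<dots> = ennreal (bergman_weight \<xi> k)"
    unfolding bergman_weight_def
  proof (rule nn_integral_has_integral_lebesgue')
    show "((\<lambda>s. (\<xi> + 1) * (s powr (real k + 1 - 1) * (1 - s) powr (\<xi> + 1 - 1))) has_integral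
        (\<xi> + 1) * Beta (real k + 1) (\<xi> + 1)) {0<..<1}"
      using has_integral_Beta_real[of "real k + 1" "\<xi> + 1"] assms
      by (intro has_integral_mult_right) (simp add: has_integral_Icc_iff_Ioo)
  qed (use assms in auto)
  finally show ?thesis .
qed

lemma finite_bergman_measure:
  assumes "\<xi> > -1"
  shows "finite_measure (bergman_measure \<xi>)"
proof
  have "emeasure (bergman_measure \<xi>) (space (bergman_measure \<xi>)) = ennreal (bergman_weight \<xi> 0)"
    using nn_integral_bergman_power[OF assms, of 0] by simp
  thus "emeasure (bergman_measure \<xi>) (space (bergman_measure \<xi>)) \<noteq> \<infinity>"
    by simp
qed

section \<open>Parseval's formula\<close>

text \<open>
  A rotation by \<open>\<zeta>\<close> multiplies the integrand by \<open>\<zeta>\<^sup>j \<zeta>\<^sup>-\<^sup>k\<close> and preserves the measure, so one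
  \<open>\<zeta>\<close> with \<open>\<zeta>\<^sup>j\<^sup>-\<^sup>k \<noteq> 1\<close> forces the integral to vanish. The restriction to a smaller disc is there
  because power series need not converge uniformly on the unit disc.
\<close>

lemma bergman_monomials_orthogonal:
  assumes "j \<noteq> k"
  shows "(\<integral>z. z ^ j * cnj z ^ k * indicator (ball 0 r) z \<partial>bergman_measure \<xi>) = 0" (is "?I = 0")
proof -
  (* Half a turn divided by j - k, so that the factor becomes -1. *)
  define \<zeta> where "\<zeta> = cis (pi / (real j - real k))"
  have \<zeta>: "cmod \<zeta> = 1" by (simp add: \<zeta>_def)
  have "\<zeta> ^ j * cnj \<zeta> ^ k = cis (real j * (pi / (real j - real k)) - real k * (pi / (real j - real k)))"
    by (simp add: \<zeta>_def cis_cnj Complex.DeMoivre cis_mult)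
  also have "real j * (pi / (real j - real k)) - real k * (pi / (real j - real k)) = pi"
    using assms by (simp flip: left_diff_distrib diff_divide_distrib)
  finally have neg: "\<zeta> ^ j * cnj \<zeta> ^ k = -1" by simp
  note rot = measurable_rotation_bergman_measure[OF \<zeta>, of \<xi>]
  have [measurable]: "cnj \<in> borel_measurable borel" "ball (0::complex) r \<in> sets borel"
    by (intro borel_measurable_continuous_onI continuous_intros) simp
  have meas: "(\<lambda>z. z ^ j * cnj z ^ k * indicator (ball 0 r) z) \<in> borel_measurable (bergman_measure \<xi>)"
    by (rule borel_measurable_bergman_measure) measurable
  have "?I = (\<integral>z. (\<zeta> * z) ^ j * cnj (\<zeta> * z) ^ k * indicator (ball 0 r) (\<zeta> * z) \<partial>bergman_measure \<xi>)"
    by (subst bergman_measure_rotation[OF \<zeta>, symmetric], subst integral_distr[OF rot meas]) simp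
  also have "\<dots> = (\<integral>z. (\<zeta> ^ j * cnj \<zeta> ^ k) * (z ^ j * cnj z ^ k * indicator (ball 0 r) z) \<partial>bergman_measure \<xi>)"
    by (intro Bochner_Integration.integral_cong) (auto simp: power_mult_distrib norm_mult \<zeta> indicator_def)
  also have "\<dots> = - ?I" by (simp add: neg)
  finally show ?thesis by simp
qed

text \<open>
  On a smaller disc the partial sums of the series are bounded by the convergent sum
  \<open>\<Sum>|a k| r\<^sup>k\<close>. Their square integrals are known by orthogonality, and dominated convergence
  passes to the limit.
\<close>

lemma nn_integral_bergman_power_series_disc:
  assumes \<xi>: "\<xi> > -1" and r: "0 < r" "r < 1"
    and f: "\<And>z. z \<in> ball 0 1 \<Longrightarrow> (\<lambda>k. a k * z ^ k) sums f z"
  shows "(\<integral>\<^sup>+z. ennreal ((cmod (f z))\<^sup>2) * indicator (ball 0 r) z \<partial>bergman_measure \<xi>) =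
    (\<Sum>k. \<integral>\<^sup>+z. ennreal ((cmod (a k))\<^sup>2 * cmod z ^ (2 * k)) * indicator (ball 0 r) z \<partial>bergman_measure \<xi>)"
proof -
  let ?M = "bergman_measure \<xi>"
  interpret finite_measure ?M by (rule finite_bergman_measure[OF \<xi>])
  let ?ind = "\<lambda>z. indicator (ball 0 r) z :: complex"
  let ?indr = "\<lambda>z::complex. indicator (ball 0 r) z :: real"
  define m where "m = (\<lambda>k. \<integral>z. cmod z ^ (2 * k) * ?indr z \<partial>?M)"
  define S where "S = (\<lambda>n z. \<Sum>k<n. a k * z ^ k)"
  have f_meas: "f \<in> borel_measurable ?M"
    using power_series_holomorphic[of 0 1 a f] f by (intro borel_measurable_bergman_measure_holomorphic) auto
  have [measurable]: "cnj \<in> borel_measurable borel" "ball (0::complex) r \<in> sets borel"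
    by (intro borel_measurable_continuous_onI continuous_intros) simp
  have bnd: "integrable ?M g" if "g \<in> borel_measurable borel" "\<And>z. z \<in> ball 0 1 \<Longrightarrow> norm (g z) \<le> B"
    for g :: "complex \<Rightarrow> 'b::{banach, second_countable_topology}" and B
    using that by (intro integrable_const_bound[of _ B]) (auto intro!: AE_I2 borel_measurable_bergman_measure)
  have int: "integrable ?M (\<lambda>z. z ^ j * cnj z ^ k * ?ind z)" for j k
    by (rule bnd[of _ 1])
       (measurable, auto simp: norm_mult norm_power power_le_one mult_le_one indicator_def)
  have m_int: "integrable ?M (\<lambda>z. cmod z ^ (2 * k) * ?indr z)" for k
    by (rule bnd[of _ 1])
       (measurable, auto simp: norm_mult norm_power power_le_one mult_le_one indicator_def)
  have moment: "(\<integral>z. z ^ j * cnj z ^ k * ?ind z \<partial>?M) = (if j = k then of_real (m k) else 0)" for j k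
  proof (cases "j = k")
    case True
    have "z ^ j * cnj z ^ k * ?ind z = of_real (cmod z ^ (2 * k) * ?indr z)" for z
      using True complex_norm_square[of z] by (simp add: power_mult indicator_def flip: power_mult_distrib)
    thus ?thesis using True unfolding m_def by (simp only: integral_complex_of_real) simp
  qed (simp add: bergman_monomials_orthogonal)
  have S_int: "(\<integral>z. (cmod (S n z))\<^sup>2 * ?indr z \<partial>?M) = (\<Sum>k<n. (cmod (a k))\<^sup>2 * m k)" for n
  proof -
    have "complex_of_real (\<integral>z. (cmod (S n z))\<^sup>2 * ?indr z \<partial>?M) =
        (\<integral>z. of_real ((cmod (S n z))\<^sup>2 * ?indr z) \<partial>?M)"
      by (rule integral_complex_of_real[symmetric])
    also have "\<dots> = (\<integral>z. (\<Sum>j<n. \<Sum>k<n. a j * cnj (a k) * (z ^ j * cnj z ^ k * ?ind z)) \<partial>?M)"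
    proof (rule Bochner_Integration.integral_cong[OF refl])
      fix z
      have "complex_of_real ((cmod (S n z))\<^sup>2 * ?indr z) = S n z * cnj (S n z) * ?ind z"
        using complex_norm_square[of "S n z"] by (simp add: indicator_def)
      also have "\<dots> = (\<Sum>j<n. \<Sum>k<n. a j * cnj (a k) * (z ^ j * cnj z ^ k * ?ind z))"
        unfolding S_def cnj_sum sum_product sum_distrib_right
        by (intro sum.cong refl) (simp add: sum_distrib_left mult_ac)
      finally show "complex_of_real ((cmod (S n z))\<^sup>2 * ?indr z) = \<dots>" .
    qed
    also have "\<dots> = (\<Sum>j<n. \<Sum>k<n. a j * cnj (a k) * (\<integral>z. z ^ j * cnj z ^ k * ?ind z \<partial>?M))"
      using int by (simp add: Bochner_Integration.integral_sum Bochner_Integration.integrable_sum)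
    also have "\<dots> = (\<Sum>j<n. a j * cnj (a j) * of_real (m j))"
      by (simp add: moment if_distrib[of "\<lambda>x. _ * x"] cong: if_cong)
    also have "\<dots> = of_real (\<Sum>k<n. (cmod (a k))\<^sup>2 * m k)"
      by (simp flip: complex_norm_square)
    finally show ?thesis by (simp only: of_real_eq_iff)
  qed
  have r_abs: "summable (\<lambda>k. norm (a k * of_real r ^ k))"
    (* The series converges at a point of modulus strictly between r and 1. *)
    using f[of "of_real ((r + 1) / 2)"] r
    by (intro powser_insidea[of a "of_real ((r + 1) / 2)"]) (auto simp: sums_iff simp flip: of_real_add)
  define B where "B = (\<Sum>k. norm (a k * of_real r ^ k))"
  have S_bnd: "cmod (S n z) \<le> B" if "z \<in> ball 0 r" for n z
  proof -
    have "cmod (S n z) \<le> (\<Sum>k<n. norm (a k * of_real r ^ k))"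
      unfolding S_def using that r
      by (intro sum_norm_le) (auto simp: norm_mult norm_power intro!: mult_left_mono power_mono)
    also have "\<dots> \<le> B" unfolding B_def using r_abs by (intro sum_le_suminf) auto
    finally show ?thesis .
  qed
  have f_bnd: "cmod (f z) \<le> B" if "z \<in> ball 0 r" for z
  proof (rule LIMSEQ_le_const2)
    show "(\<lambda>n. cmod (S n z)) \<longlonglongrightarrow> cmod (f z)"
      using f[of z] that r unfolding sums_def S_def by (intro tendsto_norm) auto
  qed (use S_bnd that in auto)
  have F_meas: "(\<lambda>z. (cmod (f z))\<^sup>2 * ?indr z) \<in> borel_measurable ?M"
    using f_meas by (intro borel_measurable_times borel_measurable_power borel_measurable_norm
         borel_measurable_bergman_measure[of "indicator _"]) auto
  have F_int: "integrable ?M (\<lambda>z. (cmod (f z))\<^sup>2 * ?indr z)"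
  proof (rule integrable_const_bound[of _ "B\<^sup>2"])
    show "AE z in ?M. norm ((cmod (f z))\<^sup>2 * ?indr z) \<le> B\<^sup>2"
      by (auto simp: indicator_def intro!: AE_I2 power_mono f_bnd)
  qed (rule F_meas)
  have lim: "(\<lambda>n. \<integral>z. (cmod (S n z))\<^sup>2 * ?indr z \<partial>?M) \<longlonglongrightarrow> (\<integral>z. (cmod (f z))\<^sup>2 * ?indr z \<partial>?M)"
  proof (rule integral_dominated_convergence[where w = "\<lambda>_. B\<^sup>2"])
    show "AE z in ?M. (\<lambda>n. (cmod (S n z))\<^sup>2 * ?indr z) \<longlonglongrightarrow> (cmod (f z))\<^sup>2 * ?indr z"
      using f unfolding sums_def S_def by (intro AE_I2 tendsto_intros) auto
    show "AE z in ?M. norm ((cmod (S n z))\<^sup>2 * ?indr z) \<le> B\<^sup>2" for n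
      by (auto simp: indicator_def intro!: AE_I2 power_mono S_bnd)
    show "(\<lambda>z. (cmod (S n z))\<^sup>2 * ?indr z) \<in> borel_measurable ?M" for n
      unfolding S_def by (rule borel_measurable_bergman_measure) measurable
  qed (use F_meas in auto)
  have m0: "m k \<ge> 0" for k unfolding m_def by (intro integral_nonneg_AE) auto
  have sums: "(\<lambda>k. (cmod (a k))\<^sup>2 * m k) sums (\<integral>z. (cmod (f z))\<^sup>2 * ?indr z \<partial>?M)"
    using lim unfolding S_int sums_def .
  have "(\<integral>\<^sup>+z. ennreal ((cmod (f z))\<^sup>2) * indicator (ball 0 r) z \<partial>?M) =
      (\<integral>\<^sup>+z. ennreal ((cmod (f z))\<^sup>2 * ?indr z) \<partial>?M)"
    by (intro nn_integral_cong) (auto simp: indicator_def)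
  also have "\<dots> = ennreal (\<integral>z. (cmod (f z))\<^sup>2 * ?indr z \<partial>?M)"
    using F_int by (intro nn_integral_eq_integral) auto
  also have "\<dots> = (\<Sum>k. ennreal ((cmod (a k))\<^sup>2 * m k))"
    using sums m0 by (subst suminf_ennreal_eq[OF _ sums]) auto
  also have "\<dots> = (\<Sum>k. \<integral>\<^sup>+z. ennreal ((cmod (a k))\<^sup>2 * cmod z ^ (2 * k)) * indicator (ball 0 r) z \<partial>?M)"
  proof (rule arg_cong[of _ _ suminf], rule ext)
    fix k
    have "ennreal ((cmod (a k))\<^sup>2 * m k) = ennreal (\<integral>z. (cmod (a k))\<^sup>2 * (cmod z ^ (2 * k) * ?indr z) \<partial>?M)"
      by (simp add: m_def)
    also have "\<dots> = (\<integral>\<^sup>+z. ennreal ((cmod (a k))\<^sup>2 * (cmod z ^ (2 * k) * ?indr z)) \<partial>?M)"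
      using m_int[of k] by (intro nn_integral_eq_integral[symmetric]) auto
    also have "\<dots> = (\<integral>\<^sup>+z. ennreal ((cmod (a k))\<^sup>2 * cmod z ^ (2 * k)) * indicator (ball 0 r) z \<partial>?M)"
      by (intro nn_integral_cong) (auto simp: indicator_def)
    finally show "ennreal ((cmod (a k))\<^sup>2 * m k) = \<dots>" .
  qed
  finally show ?thesis .
qed

text \<open>
  Monotone convergence along the discs of radius \<open>1 - 1 / (n + 2)\<close>; it carries identities from
  discs of radius less than 1, where power series converge uniformly, to the whole disc.
\<close>

lemma nn_integral_bergman_exhaustion:
  assumes [measurable]: "F \<in> borel_measurable (bergman_measure \<xi>)"
  shows "(\<integral>\<^sup>+z. F z \<partial>bergman_measure \<xi>) =
    (SUP n. \<integral>\<^sup>+z. F z * indicator (ball 0 (1 - 1 / real (n + 2))) z \<partial>bergman_measure \<xi>)"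
proof -
  let ?R = "\<lambda>n. 1 - 1 / real (n + 2)"
  have "(\<integral>\<^sup>+z. F z \<partial>bergman_measure \<xi>) =
      (\<integral>\<^sup>+z. (SUP n. F z * indicator (ball 0 (?R n)) z) \<partial>bergman_measure \<xi>)"
  proof (rule nn_integral_cong)
    fix z :: complex assume "z \<in> space (bergman_measure \<xi>)"
    hence "cmod z < 1" by simp
    moreover have "?R \<longlonglongrightarrow> 1" by real_asymp
    ultimately have "eventually (\<lambda>n. cmod z < ?R n) sequentially"
      by (rule order_tendstoD(1)[rotated])
    then obtain n where "cmod z < ?R n" by (auto simp: eventually_sequentially)
    hence "F z \<le> (SUP n. F z * indicator (ball 0 (?R n)) z)"
      by (intro SUP_upper2[of n]) auto
    moreover have "(SUP n. F z * indicator (ball 0 (?R n)) z) \<le> F z"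
      by (intro SUP_least) (auto simp: indicator_def)
    ultimately show "F z = (SUP n. F z * indicator (ball 0 (?R n)) z)" by (rule antisym)
  qed
  also have "\<dots> = (SUP n. \<integral>\<^sup>+z. F z * indicator (ball 0 (?R n)) z \<partial>bergman_measure \<xi>)"
  proof (rule nn_integral_monotone_convergence_SUP)
    have "?R m \<le> ?R n" if "m \<le> n" for m n
      using that by (simp add: frac_le)
    hence "(indicator (ball 0 (?R m)) z :: ennreal) \<le> indicator (ball 0 (?R n)) z"
      if "m \<le> n" for m n and z :: complex
      using that by (auto simp: indicator_def intro: less_le_trans)
    thus "incseq (\<lambda>n z. F z * indicator (ball 0 (?R n)) z)"
      by (auto intro!: monoI le_funI mult_left_mono)
    show "(\<lambda>z. F z * indicator (ball 0 (?R n)) z) \<in> borel_measurable (bergman_measure \<xi>)" for n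
      by (rule borel_measurable_times_ennreal[OF assms
            borel_measurable_bergman_measure[OF borel_measurable_indicator]]) simp
  qed
  finally show ?thesis .
qed

text \<open>
  Parseval's formula. The two nonnegative sides may both be infinite, so the identity also
  decides which holomorphic functions belong to the Bergman space.
\<close>

lemma nn_integral_bergman_power_series:
  assumes \<xi>: "\<xi> > -1"
    and f: "\<And>z. z \<in> ball 0 1 \<Longrightarrow> (\<lambda>k. a k * z ^ k) sums f z"
  shows "(\<integral>\<^sup>+z. ennreal ((cmod (f z))\<^sup>2) \<partial>bergman_measure \<xi>) =
    (\<Sum>k. ennreal ((cmod (a k))\<^sup>2 * bergman_weight \<xi> k))"
proof -
  let ?M = "bergman_measure \<xi>"
  let ?G = "\<lambda>z::complex. \<Sum>k. ennreal ((cmod (a k))\<^sup>2 * cmod z ^ (2 * k))"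
  have [measurable]: "f \<in> borel_measurable ?M"
    using power_series_holomorphic[of 0 1 a f] f by (intro borel_measurable_bergman_measure_holomorphic) auto
  have [measurable]: "(\<lambda>z. ennreal ((cmod (a k))\<^sup>2 * cmod z ^ (2 * k))) \<in> borel_measurable ?M" for k
    by (rule borel_measurable_bergman_measure) measurable
  have [measurable]: "ball (0::complex) r \<in> sets borel" for r by simp
  have [measurable]: "(\<lambda>z. indicator (ball 0 r) z :: ennreal) \<in> borel_measurable ?M" for r
    by (rule borel_measurable_bergman_measure) measurable
  have "(\<integral>\<^sup>+z. ennreal ((cmod (f z))\<^sup>2) * indicator (ball 0 (1 - 1 / real (n + 2))) z \<partial>?M) =
      (\<integral>\<^sup>+z. ?G z * indicator (ball 0 (1 - 1 / real (n + 2))) z \<partial>?M)" for n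
    by (subst nn_integral_bergman_power_series_disc[OF \<xi> _ _ f])
       (auto simp: nn_integral_suminf[symmetric] simp flip: ennreal_suminf_multc)
  moreover have "(\<lambda>z. ennreal ((cmod (f z))\<^sup>2)) \<in> borel_measurable ?M" "?G \<in> borel_measurable ?M"
    by measurable
  ultimately have "(\<integral>\<^sup>+z. ennreal ((cmod (f z))\<^sup>2) \<partial>?M) = (\<integral>\<^sup>+z. ?G z \<partial>?M)"
    by (simp only: nn_integral_bergman_exhaustion)
  also have "\<dots> = (\<Sum>k. \<integral>\<^sup>+z. ennreal ((cmod (a k))\<^sup>2 * cmod z ^ (2 * k)) \<partial>?M)"
    by (rule nn_integral_suminf) measurable
  also have "\<dots> = (\<Sum>k. ennreal ((cmod (a k))\<^sup>2 * bergman_weight \<xi> k))"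
  proof (rule arg_cong[of _ _ suminf], rule ext)
    fix k
    have "(\<lambda>z. ennreal (cmod z ^ (2 * k))) \<in> borel_measurable ?M"
      by (rule borel_measurable_bergman_measure) measurable
    thus "(\<integral>\<^sup>+z. ennreal ((cmod (a k))\<^sup>2 * cmod z ^ (2 * k)) \<partial>?M) =
        ennreal ((cmod (a k))\<^sup>2 * bergman_weight \<xi> k)"
      by (simp add: ennreal_mult' nn_integral_cmult nn_integral_bergman_power[OF \<xi>])
  qed
  finally show ?thesis .
qed

section \<open>Comparison of the weights\<close>

lemma bergman_weight_pos:
  assumes "\<xi> > -1"
  shows "bergman_weight \<xi> k > 0"
  using assms by (simp add: bergman_weight_def Beta_def Gamma_real_pos)

text \<open>
  Two applications of the recurrence \<open>Beta x (y + 1) = y / (x + y) * Beta x y\<close>.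
\<close>

lemma bergman_weight_add_2:
  assumes "\<xi> > -1"
  shows "bergman_weight (\<xi> + 2) k =
    (\<xi> + 2) * (\<xi> + 3) / ((real k + \<xi> + 2) * (real k + \<xi> + 3)) * bergman_weight \<xi> k"
proof -
  have step: "Beta (real k + 1) (y + 1) = y / (real k + 1 + y) * Beta (real k + 1) y" if "y > 0" for y :: real
    using Beta_plus1_right[of y "real k + 1"] that
    by (auto simp: field_simps nonpos_Ints_def)
  have "Beta (real k + 1) (\<xi> + 1 + 1 + 1) =
      (\<xi> + 2) / (real k + \<xi> + 3) * ((\<xi> + 1) / (real k + \<xi> + 2) * Beta (real k + 1) (\<xi> + 1))"
    using assms by (subst step, simp, subst step, simp) (simp add: add_ac)
  moreover have "\<xi> + 2 + 1 = \<xi> + 1 + 1 + 1" by simp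
  ultimately show ?thesis
    unfolding bergman_weight_def by (simp add: mult_ac add_ac)
qed

lemma of_nat_add_ne_0:
  fixes c :: real
  assumes "c \<notin> \<int>\<^sub>\<le>\<^sub>0"
  shows "real k + c \<noteq> 0"
proof
  assume "real k + c = 0"
  hence "c = - real k" by simp
  with assms show False by simp
qed

text \<open>
  By the recurrence for the weights the two sequences have the ratio
  \[ q_k = \frac{(k+c)^2 (\xi+2)(\xi+3)}{(k+\xi+2)(k+\xi+3)}, \]
  which is positive for every \<open>k\<close> because \<open>c\<close> is not a nonpositive integer, and which
  tends to the positive limit \<open>(\<xi> + 2) (\<xi> + 3)\<close>. Hence \<open>q\<close> and \<open>1 / q\<close> are both bounded.
\<close>

lemma bergman_weight_comparable:
  assumes \<xi>: "\<xi> > -1" and c: "c \<notin> \<int>\<^sub>\<le>\<^sub>0"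
  obtains C where "C > 0"
    and "\<And>k. (real k + c)\<^sup>2 * bergman_weight (\<xi> + 2) k \<le> C * bergman_weight \<xi> k"
    and "\<And>k. bergman_weight \<xi> k \<le> C * ((real k + c)\<^sup>2 * bergman_weight (\<xi> + 2) k)"
proof -
  define q where "q = (\<lambda>k. (real k + c)\<^sup>2 * ((\<xi> + 2) * (\<xi> + 3) / ((real k + \<xi> + 2) * (real k + \<xi> + 3))))"
  define L where "L = (\<xi> + 2) * (\<xi> + 3)"
  have "L > 0" using \<xi> by (simp add: L_def)
  have "(\<lambda>k. (real k + c)\<^sup>2 / ((real k + \<xi> + 2) * (real k + \<xi> + 3))) \<longlonglongrightarrow> 1"
    by real_asymp
  from tendsto_mult_left[OF this, of L] have q_lim: "q \<longlonglongrightarrow> L"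
    by (simp add: q_def L_def mult_ac)
  hence "(\<lambda>k. inverse (q k)) \<longlonglongrightarrow> inverse L"
    using \<open>L > 0\<close> by (intro tendsto_inverse) auto
  hence "Bseq (\<lambda>k. inverse (q k))"
    by (intro convergent_imp_Bseq convergentI)
  then obtain B where B: "B > 0" "\<And>k. norm (inverse (q k)) \<le> B"
    by (elim BseqE) auto
  have "Bseq q"
    using q_lim by (intro convergent_imp_Bseq convergentI)
  then obtain A where A: "A > 0" "\<And>k. norm (q k) \<le> A"
    by (elim BseqE) auto
  have q_pos: "q k > 0" for k
  proof -
    have "real k + c \<noteq> 0" by (rule of_nat_add_ne_0[OF c])
    thus ?thesis using \<xi> by (simp add: q_def)
  qed
  have w: "(real k + c)\<^sup>2 * bergman_weight (\<xi> + 2) k = q k * bergman_weight \<xi> k" for k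
    by (simp add: q_def bergman_weight_add_2[OF \<xi>])
  show ?thesis
  proof (rule that[of "max A B"])
    fix k
    have pos: "bergman_weight \<xi> k > 0" by (rule bergman_weight_pos[OF \<xi>])
    have "q k \<le> max A B" using A(2)[of k] by simp
    thus "(real k + c)\<^sup>2 * bergman_weight (\<xi> + 2) k \<le> max A B * bergman_weight \<xi> k"
      unfolding w using pos by (intro mult_right_mono) auto
    have "inverse (q k) \<le> max A B" using B(2)[of k] q_pos[of k] by simp
    hence "1 \<le> max A B * q k"
      using q_pos[of k] by (simp add: field_simps)
    hence "1 * bergman_weight \<xi> k \<le> (max A B * q k) * bergman_weight \<xi> k"
      using pos by (intro mult_right_mono) auto
    thus "bergman_weight \<xi> k \<le> max A B * ((real k + c)\<^sup>2 * bergman_weight (\<xi> + 2) k)"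
      unfolding w by (simp add: mult_ac)
  qed (use A(1) in simp)
qed

section \<open>The operator on power series and on Bergman spaces\<close>

lemma holomorphic_disc_power_series:
  assumes "f holomorphic_on ball 0 1"
  obtains a where "\<And>z. z \<in> ball 0 1 \<Longrightarrow> (\<lambda>k. a k * z ^ k) sums f z"
proof (rule that[of "\<lambda>k. (deriv ^^ k) f 0 / fact k"])
  show "(\<lambda>k. (deriv ^^ k) f 0 / fact k * z ^ k) sums f z" if "z \<in> ball 0 1" for z
    using holomorphic_power_series[OF assms that] by simp
qed

lemma L_op_power_series:
  assumes f: "\<And>z. z \<in> ball 0 1 \<Longrightarrow> (\<lambda>k. a k * z ^ k) sums f z" and z: "z \<in> ball 0 1"
  shows "(\<lambda>k. of_real (real k + c) * a k * z ^ k) sums L_op c f z"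
proof -
  have "f holomorphic_on ball 0 1"
    using power_series_holomorphic[of 0 1 a f] f by auto
  hence "(f has_field_derivative deriv f z) (at z)"
    using z by (intro holomorphic_derivI) auto
  hence "(\<lambda>k. diffs a k * z ^ k) sums deriv f z"
    using f z by (intro termdiffs_sums_strong[of 1 a f]) auto
  from sums_mult[OF this, of z] have "(\<lambda>k. of_nat (Suc k) * a (Suc k) * z ^ Suc k) sums (z * deriv f z)"
    by (simp add: diffs_def mult_ac)
  hence "(\<lambda>k. of_nat k * a k * z ^ k) sums (z * deriv f z)"
    using sums_Suc_iff[of "\<lambda>k. of_nat k * a k * z ^ k" "z * deriv f z"] by simp
  from sums_add[OF this sums_mult[OF f[OF z], of "of_real c"]] z show ?thesis
    by (simp add: L_op_def algebra_simps)
qed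

text \<open>
  Parseval's formula turns the comparison of weights, term by term, into a comparison of
  square integrals. Infinite values are included, so \<open>|f|\<^sup>2\<close> is integrable for \<open>\<xi>\<close>
  if and only if \<open>|L_op c f|\<^sup>2\<close> is integrable for \<open>\<xi> + 2\<close>.
\<close>

lemma L_op_norm_equivalence:
  assumes \<xi>: "\<xi> > -1" and c: "c \<notin> \<int>\<^sub>\<le>\<^sub>0"
  obtains C where "C > 0"
    and "\<And>f. f holomorphic_on ball 0 1 \<Longrightarrow>
      (\<integral>\<^sup>+z. ennreal ((cmod (L_op c f z))\<^sup>2) \<partial>bergman_measure (\<xi> + 2)) \<le>
      ennreal C * (\<integral>\<^sup>+z. ennreal ((cmod (f z))\<^sup>2) \<partial>bergman_measure \<xi>)"
    and "\<And>f. f holomorphic_on ball 0 1 \<Longrightarrow>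
      (\<integral>\<^sup>+z. ennreal ((cmod (f z))\<^sup>2) \<partial>bergman_measure \<xi>) \<le>
      ennreal C * (\<integral>\<^sup>+z. ennreal ((cmod (L_op c f z))\<^sup>2) \<partial>bergman_measure (\<xi> + 2))"
proof -
  obtain C where C: "C > 0"
    "\<And>k. (real k + c)\<^sup>2 * bergman_weight (\<xi> + 2) k \<le> C * bergman_weight \<xi> k"
    "\<And>k. bergman_weight \<xi> k \<le> C * ((real k + c)\<^sup>2 * bergman_weight (\<xi> + 2) k)"
    by (rule bergman_weight_comparable[OF assms]) (rule that)
  show ?thesis
  proof (rule that[OF C(1)])
    fix f assume "f holomorphic_on ball 0 1"
    then obtain a where a: "\<And>z. z \<in> ball 0 1 \<Longrightarrow> (\<lambda>k. a k * z ^ k) sums f z"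
      using holomorphic_disc_power_series by blast
    have N: "(\<integral>\<^sup>+z. ennreal ((cmod (f z))\<^sup>2) \<partial>bergman_measure \<xi>) =
        (\<Sum>k. ennreal ((cmod (a k))\<^sup>2 * bergman_weight \<xi> k))"
      using \<xi> a by (rule nn_integral_bergman_power_series)
    have "(\<integral>\<^sup>+z. ennreal ((cmod (L_op c f z))\<^sup>2) \<partial>bergman_measure (\<xi> + 2)) =
        (\<Sum>k. ennreal ((cmod (of_real (real k + c) * a k))\<^sup>2 * bergman_weight (\<xi> + 2) k))"
      using \<xi> by (intro nn_integral_bergman_power_series L_op_power_series[OF a]) auto
    also have "\<dots> = (\<Sum>k. ennreal ((cmod (a k))\<^sup>2 * ((real k + c)\<^sup>2 * bergman_weight (\<xi> + 2) k)))"
      by (simp only: norm_mult norm_of_real power_mult_distrib power2_abs mult_ac)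
    finally have NL: "(\<integral>\<^sup>+z. ennreal ((cmod (L_op c f z))\<^sup>2) \<partial>bergman_measure (\<xi> + 2)) = \<dots>" .
    have mono: "(\<Sum>k. ennreal ((cmod (a k))\<^sup>2 * u k)) \<le> ennreal C * (\<Sum>k. ennreal ((cmod (a k))\<^sup>2 * v k))"
      if "\<And>k. u k \<le> C * v k" for u v :: "nat \<Rightarrow> real"
    proof -
      have "ennreal ((cmod (a k))\<^sup>2 * u k) \<le> ennreal C * ennreal ((cmod (a k))\<^sup>2 * v k)" for k
        using mult_left_mono[OF that[of k], of "(cmod (a k))\<^sup>2"] C(1)
        by (auto simp: mult_ac simp flip: ennreal_mult' intro!: ennreal_leI)
      thus ?thesis
        by (subst ennreal_suminf_cmult[symmetric]) (intro suminf_le summableI)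
    qed
    show "(\<integral>\<^sup>+z. ennreal ((cmod (L_op c f z))\<^sup>2) \<partial>bergman_measure (\<xi> + 2)) \<le>
      ennreal C * (\<integral>\<^sup>+z. ennreal ((cmod (f z))\<^sup>2) \<partial>bergman_measure \<xi>)"
      unfolding N NL by (rule mono[OF C(2)])
    show "(\<integral>\<^sup>+z. ennreal ((cmod (f z))\<^sup>2) \<partial>bergman_measure \<xi>) \<le>
      ennreal C * (\<integral>\<^sup>+z. ennreal ((cmod (L_op c f z))\<^sup>2) \<partial>bergman_measure (\<xi> + 2))"
      unfolding N NL by (rule mono[OF C(3)])
  qed
qed

lemma nn_integral_bergman_space:
  assumes "f \<in> bergman_space \<xi>"
  shows "(\<integral>\<^sup>+z. ennreal ((cmod (f z))\<^sup>2) \<partial>bergman_measure \<xi>) = ennreal ((bergman_norm \<xi> f)\<^sup>2)"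
proof -
  have "integrable (bergman_measure \<xi>) (\<lambda>z. (cmod (f z))\<^sup>2)"
    using assms by (simp add: bergman_space_def)
  hence "(\<integral>\<^sup>+z. ennreal ((cmod (f z))\<^sup>2) \<partial>bergman_measure \<xi>) =
      ennreal (\<integral>z. (cmod (f z))\<^sup>2 \<partial>bergman_measure \<xi>)"
    by (intro nn_integral_eq_integral) auto
  thus ?thesis by (simp add: bergman_norm_def)
qed

text \<open>
  With two parameters left free, this serves both the operator, which raises the parameter, and
  its inverse, which lowers it.
\<close>

lemma bergman_space_dominated:
  assumes f: "f \<in> bergman_space \<xi>" and C: "C \<ge> 0"
    and g: "g holomorphic_on ball 0 1" "\<And>z. z \<notin> ball 0 1 \<Longrightarrow> g z = 0"
    and le: "(\<integral>\<^sup>+z. ennreal ((cmod (g z))\<^sup>2) \<partial>bergman_measure \<eta>) \<le>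
      ennreal C * (\<integral>\<^sup>+z. ennreal ((cmod (f z))\<^sup>2) \<partial>bergman_measure \<xi>)"
  shows "g \<in> bergman_space \<eta>" and "bergman_norm \<eta> g \<le> sqrt C * bergman_norm \<xi> f"
proof -
  have le': "(\<integral>\<^sup>+z. ennreal ((cmod (g z))\<^sup>2) \<partial>bergman_measure \<eta>) \<le> ennreal (C * (bergman_norm \<xi> f)\<^sup>2)"
    using le C by (simp add: nn_integral_bergman_space[OF f] ennreal_mult')
  have "integrable (bergman_measure \<eta>) (\<lambda>z. (cmod (g z))\<^sup>2)"
  proof (rule integrableI_nonneg)
    have [measurable]: "g \<in> borel_measurable (bergman_measure \<eta>)"
      by (rule borel_measurable_bergman_measure_holomorphic[OF g(1)])
    show "(\<lambda>z. (cmod (g z))\<^sup>2) \<in> borel_measurable (bergman_measure \<eta>)"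
      by measurable
    show "(\<integral>\<^sup>+z. ennreal ((cmod (g z))\<^sup>2) \<partial>bergman_measure \<eta>) < \<infinity>"
      using le' by (rule order.strict_trans1) simp
  qed simp
  with g show g': "g \<in> bergman_space \<eta>" by (auto simp: bergman_space_def)
  have norm0: "bergman_norm \<xi> f \<ge> 0"
    by (simp add: bergman_norm_def)
  have "(bergman_norm \<eta> g)\<^sup>2 \<le> (sqrt C * bergman_norm \<xi> f)\<^sup>2"
    using le' C unfolding nn_integral_bergman_space[OF g']
    by (subst (asm) ennreal_le_iff) (simp_all add: power_mult_distrib)
  thus "bergman_norm \<eta> g \<le> sqrt C * bergman_norm \<xi> f"
    by (rule power2_le_imp_le) (use norm0 C in simp)
qed

lemma L_op_holomorphic:
  assumes "f holomorphic_on ball 0 1"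
  shows "L_op c f holomorphic_on ball 0 1"
proof -
  have "(\<lambda>z. z * deriv f z + of_real c * f z) holomorphic_on ball 0 1"
    using assms by (intro holomorphic_intros) auto
  thus ?thesis by (rule holomorphic_transform) (simp add: L_op_def)
qed

lemma L_op_linear:
  assumes "\<And>f. f \<in> X \<Longrightarrow> f holomorphic_on ball 0 1"
  shows "linear_between X (L_op c)"
proof -
  have "f field_differentiable at z" if "f \<in> X" "cmod z < 1" for f z
    using assms[OF that(1)] that(2) by (intro holomorphic_on_imp_differentiable_at) auto
  thus ?thesis
    unfolding linear_between_def L_op_def by (auto simp: fun_eq_iff algebra_simps)
qed

text \<open>
  The lower norm bound makes the square integral of \<open>f\<close> vanish, and by Parseval's
  formula all coefficients of \<open>f\<close> vanish with it.
\<close>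

lemma L_op_eq_0_imp_eq_0:
  fixes \<xi> :: real
  assumes \<xi>: "\<xi> > -1" and c: "c \<notin> \<int>\<^sub>\<le>\<^sub>0" and f: "f holomorphic_on ball 0 1"
    and L: "\<And>z. z \<in> ball 0 1 \<Longrightarrow> L_op c f z = 0" and z: "z \<in> ball 0 1"
  shows "f z = 0"
proof -
  obtain C where C: "(\<integral>\<^sup>+z. ennreal ((cmod (f z))\<^sup>2) \<partial>bergman_measure \<xi>) \<le>
      ennreal C * (\<integral>\<^sup>+z. ennreal ((cmod (L_op c f z))\<^sup>2) \<partial>bergman_measure (\<xi> + 2))"
    by (rule L_op_norm_equivalence[OF \<xi> c]) (rule that, use f in blast)
  obtain a where a: "\<And>z. z \<in> ball 0 1 \<Longrightarrow> (\<lambda>k. a k * z ^ k) sums f z"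
    using holomorphic_disc_power_series[OF f] by blast
  have "(\<integral>\<^sup>+z. ennreal ((cmod (L_op c f z))\<^sup>2) \<partial>bergman_measure (\<xi> + 2)) =
      (\<integral>\<^sup>+z. 0 \<partial>bergman_measure (\<xi> + 2))"
    using L by (intro nn_integral_cong) auto
  moreover have "(\<integral>\<^sup>+z. ennreal ((cmod (f z))\<^sup>2) \<partial>bergman_measure \<xi>) =
      (\<Sum>k. ennreal ((cmod (a k))\<^sup>2 * bergman_weight \<xi> k))"
    using \<xi> a by (rule nn_integral_bergman_power_series)
  ultimately have "(\<Sum>k. ennreal ((cmod (a k))\<^sup>2 * bergman_weight \<xi> k)) = 0"
    using C by simp
  hence "ennreal ((cmod (a k))\<^sup>2 * bergman_weight \<xi> k) = 0" for k
    by (subst (asm) suminf_eq_zero_iff) auto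
  moreover have "bergman_weight \<xi> k > 0" for k
    by (rule bergman_weight_pos[OF \<xi>])
  ultimately have "a k = 0" for k
    by (simp add: ennreal_eq_0_iff mult_le_0_iff less_le_not_le)
  with a[OF z] show ?thesis by (simp add: sums_iff)
qed

text \<open>
  Dividing the coefficients of \<open>g\<close> by \<open>k + c\<close> solves the equation formally. These
  divisors stay away from 0, so the new series still converges on the whole disc.
\<close>

lemma L_op_surjective_holomorphic:
  assumes c: "c \<notin> \<int>\<^sub>\<le>\<^sub>0" and g: "g holomorphic_on ball 0 1"
  obtains f where "f holomorphic_on ball 0 1" "\<And>z. z \<notin> ball 0 1 \<Longrightarrow> f z = 0"
    "\<And>z. z \<in> ball 0 1 \<Longrightarrow> L_op c f z = g z"
proof -
  obtain b where b: "\<And>z. z \<in> ball 0 1 \<Longrightarrow> (\<lambda>k. b k * z ^ k) sums g z"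
    using holomorphic_disc_power_series[OF g] by blast
  define a where "a = (\<lambda>k. b k / of_real (real k + c))"
  have nz: "real k + c \<noteq> 0" for k by (rule of_nat_add_ne_0[OF c])
  have "(\<lambda>k. 1 / (real k + c)) \<longlonglongrightarrow> 0" by real_asymp
  hence "Bseq (\<lambda>k. 1 / (real k + c))"
    by (intro convergent_imp_Bseq convergentI)
  then obtain B where B: "B > 0" "\<And>k. norm (1 / (real k + c)) \<le> B"
    by (elim BseqE) auto
  have summ: "summable (\<lambda>k. a k * z ^ k)" if z: "z \<in> ball 0 1" for z
  proof (rule summable_comparison_test'[where N = 0])
    define \<rho> where "\<rho> = (cmod z + 1) / 2"
    have \<rho>: "cmod z < \<rho>" "\<rho> < 1" using z by (auto simp: \<rho>_def)
    hence \<rho>0: "0 < \<rho>" using norm_ge_zero[of z] by linarith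
    have "summable (\<lambda>k. norm (b k * z ^ k))"
      using b[of "of_real \<rho>"] \<rho> \<rho>0 by (intro powser_insidea[of b "of_real \<rho>"]) (auto simp: sums_iff)
    thus "summable (\<lambda>k. B * norm (b k * z ^ k))" by (rule summable_mult)
    show "norm (a k * z ^ k) \<le> B * norm (b k * z ^ k)" for k
    proof -
      have "norm (a k * z ^ k) = norm (1 / (real k + c)) * norm (b k * z ^ k)"
        by (simp only: a_def norm_mult norm_divide norm_of_real norm_one real_norm_def) simp
      also have "\<dots> \<le> B * norm (b k * z ^ k)"
        by (intro mult_right_mono B) auto
      finally show ?thesis .
    qed
  qed
  define f where "f = (\<lambda>z. if z \<in> ball 0 1 then \<Sum>k. a k * z ^ k else 0)"
  have f: "(\<lambda>k. a k * z ^ k) sums f z" if "z \<in> ball 0 1" for z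
    using summ[OF that] that by (simp add: f_def sums_iff)
  show ?thesis
  proof (rule that[of f])
    show "f holomorphic_on ball 0 1"
      using power_series_holomorphic[of 0 1 a f] f by auto
    show "L_op c f z = g z" if "z \<in> ball 0 1" for z
    proof -
      have "of_real (real k + c) * a k = b k" for k
        using nz[of k] unfolding a_def by (simp del: of_real_add)
      with L_op_power_series[OF f that, of c] have "(\<lambda>k. b k * z ^ k) sums L_op c f z"
        by (simp del: of_real_add)
      thus ?thesis using b[OF that] by (rule sums_unique2)
    qed
  qed (auto simp: f_def)
qed

theorem theorem12:
  fixes \<xi> c :: real
  assumes "\<xi> > -1"
    and "c \<notin> \<int>\<^sub>\<le>\<^sub>0"
  shows "normed_space_iso (bergman_space \<xi>) (bergman_norm \<xi>)
           (bergman_space (\<xi> + 2)) (bergman_norm (\<xi> + 2)) (L_op c)"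
proof -
  let ?X = "bergman_space \<xi>" and ?Y = "bergman_space (\<xi> + 2)"
  obtain C where C: "C > 0"
    and up: "\<And>f. f holomorphic_on ball 0 1 \<Longrightarrow>
      (\<integral>\<^sup>+z. ennreal ((cmod (L_op c f z))\<^sup>2) \<partial>bergman_measure (\<xi> + 2)) \<le>
      ennreal C * (\<integral>\<^sup>+z. ennreal ((cmod (f z))\<^sup>2) \<partial>bergman_measure \<xi>)"
    and down: "\<And>f. f holomorphic_on ball 0 1 \<Longrightarrow>
      (\<integral>\<^sup>+z. ennreal ((cmod (f z))\<^sup>2) \<partial>bergman_measure \<xi>) \<le>
      ennreal C * (\<integral>\<^sup>+z. ennreal ((cmod (L_op c f z))\<^sup>2) \<partial>bergman_measure (\<xi> + 2))"
    using L_op_norm_equivalence[OF assms] by blast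
  have X: "f holomorphic_on ball 0 1" "z \<notin> ball 0 1 \<Longrightarrow> f z = 0" if "f \<in> bergman_space \<eta>" for f z \<eta>
    using that by (auto simp: bergman_space_def)
  have lin: "linear_between ?X (L_op c)"
    by (rule L_op_linear) (rule X)
  have outside: "L_op c f z = 0" if "z \<notin> ball 0 1" for f z
    using that by (simp add: L_op_def)
  have into: "L_op c f \<in> ?Y" "bergman_norm (\<xi> + 2) (L_op c f) \<le> sqrt C * bergman_norm \<xi> f"
    if "f \<in> ?X" for f
    using bergman_space_dominated[OF that _ L_op_holomorphic[OF X(1)[OF that]] outside up[OF X(1)[OF that]]] C
    by simp_all
  have inj: "inj_on (L_op c) ?X"
  proof (rule inj_onI)
    fix f g assume f: "f \<in> ?X" and g: "g \<in> ?X" and eq: "L_op c f = L_op c g"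
    have g': "(\<lambda>z. (-1) * g z) \<in> ?X" by (rule bergman_space_scale[OF g])
    define h where "h = (\<lambda>z. f z + (-1) * g z)"
    have h: "h \<in> ?X" unfolding h_def by (rule bergman_space_add[OF f g'])
    have "L_op c h = (\<lambda>z. L_op c f z + L_op c (\<lambda>z. (-1) * g z) z)"
      unfolding h_def
      using lin[unfolded linear_between_def, THEN conjunct1, rule_format, OF f g'] .
    also have "L_op c (\<lambda>z. (-1) * g z) = (\<lambda>z. (-1) * L_op c g z)"
      using lin[unfolded linear_between_def, THEN conjunct2, rule_format, OF g] .
    finally have "L_op c h z = 0" for z by (simp add: eq)
    hence "h z = 0" for z
      using L_op_eq_0_imp_eq_0[OF assms X(1)[OF h]] X(2)[OF h] by (cases "z \<in> ball 0 1") blast+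
    thus "f = g" by (auto simp: h_def)
  qed
  have surj: "\<exists>f\<in>?X. L_op c f = g" if g: "g \<in> ?Y" for g
  proof -
    obtain f where f: "f holomorphic_on ball 0 1" "\<And>z. z \<notin> ball 0 1 \<Longrightarrow> f z = 0"
      "\<And>z. z \<in> ball 0 1 \<Longrightarrow> L_op c f z = g z"
      using L_op_surjective_holomorphic[OF assms(2) X(1)[OF g]] by blast
    have eq: "L_op c f = g"
    proof
      show "L_op c f z = g z" for z
        using f(3) X(2)[OF g] outside by (cases "z \<in> ball 0 1") simp_all
    qed
    have "f \<in> ?X"
      using bergman_space_dominated(1)[OF g _ f(1,2) down[OF f(1), unfolded eq]] C by simp
    with eq show ?thesis by blast
  qed
  have bij: "bij_betw (L_op c) ?X ?Y"
    unfolding bij_betw_def using inj into(1) surj by blast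
  have inv: "bergman_norm \<xi> (inv_into ?X (L_op c) g) \<le> sqrt C * bergman_norm (\<xi> + 2) g" if g: "g \<in> ?Y" for g
  proof -
    define f where "f = inv_into ?X (L_op c) g"
    have f: "f \<in> ?X" and eq: "L_op c f = g"
      using bij g unfolding f_def by (auto simp: bij_betw_def inv_into_into f_inv_into_f)
    show ?thesis
      using bergman_space_dominated(2)[OF g _ X[OF f] down[OF X(1)[OF f], unfolded eq]] C
      by (simp add: f_def)
  qed
  show ?thesis
    unfolding normed_space_iso_def
    by (intro conjI lin bij exI[of _ "sqrt C"] ballI into(2) inv)
qed

end
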